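(* Let $n\ge 3$ and $r\ge 1$ be integers, and let $G$ be a finite simple connected graph with $N_0$ vertices and $E_0$ edges. Let $CL_r(G)$ be the $r$-th clique-blew up iterative graph of $G$, and let $\tau(H)$ denote the number of spanning trees of a graph $H$. Then $$\tau(CL_r(G))=2^{\,2E_0\alpha-rN_0-\frac{2E_0}{n+1}(2\alpha-r)+r}\cdot n^{\,2(n-3)E_0\alpha+rN_0+\frac{2E_0}{n+1}(2\alpha-r)-r}\cdot\tau(G),$$ where $$\alpha=\frac{\frac{n^r (n-1)^r}{2^r}-1}{n^2-n-2}.$$
   Context: Clique-blew up graph: fix an integer $n\ge 3$. For a graph $G$, the graph $CL(G)$ is obtained from $G$ by adding, for every edge $e$ of $G$, $n-2$ new vertices (distinct edges receive disjoint sets of new vertices) and the edges needed so that these new vertices together with the two end-vertices of $e$ form a complete graph $K_n$. Iterates: $CL_0(G)=G$ and $CL_r(G)=CL(CL_{r-1}(G))$ for $r\ge1$ (with the same $n$ at every step). *)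

theory Defs
  imports Complex_Main "HOL-Library.FSet"
begin

section \<open>Simple graphs and spanning trees\<close>

text \<open>
  An undirected graph is a vertex set together with a set of edges, an edge being the set of its
  two end-vertices.
\<close>

record 'a ugraph =
  verts :: "'a set"
  edges :: "'a set set"

definition finite_simple_graph :: "'a ugraph \<Rightarrow> bool" where
  "finite_simple_graph G \<longleftrightarrow> finite (verts G) \<and> (\<forall>e\<in>edges G. e \<subseteq> verts G \<and> card e = 2)"

definition adj_rel :: "'a ugraph \<Rightarrow> ('a \<times> 'a) set" where
  "adj_rel G = {(u, v). {u, v} \<in> edges G}"

text \<open>The null graph is not regarded as connected.\<close>

definition connected_graph :: "'a ugraph \<Rightarrow> bool" where
  "connected_graph G \<longleftrightarrow>
     verts G \<noteq> {} \<and> (\<forall>u\<in>verts G. \<forall>v\<in>verts G. (u, v) \<in> (adj_rel G)\<^sup>*)"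

text \<open>A cycle is given by the cyclic list of its distinct vertices, at least three of them.\<close>

definition graph_cycle :: "'a ugraph \<Rightarrow> 'a list \<Rightarrow> bool" where
  "graph_cycle G c \<longleftrightarrow> 3 \<le> length c \<and> distinct c \<and>
     (\<forall>i<length c. {c ! i, c ! (Suc i mod length c)} \<in> edges G)"

definition tree :: "'a ugraph \<Rightarrow> bool" where
  "tree T \<longleftrightarrow> finite_simple_graph T \<and> connected_graph T \<and> (\<nexists>c. graph_cycle T c)"

definition spanning_tree :: "'a ugraph \<Rightarrow> 'a ugraph \<Rightarrow> bool" where
  "spanning_tree T G \<longleftrightarrow> verts T = verts G \<and> edges T \<subseteq> edges G \<and> tree T"

definition num_spanning_trees :: "'a ugraph \<Rightarrow> nat" (\<open>\<tau>\<close>) where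
  "num_spanning_trees G = card {T. spanning_tree T G}"

section \<open>Clique-blown up graphs\<close>

text \<open>
  All iterates live on one vertex type. \<open>Init v\<close> is a vertex \<open>v\<close> of the initial graph. In one
  blow-up step, \<open>Old x\<close> is the copy of the vertex \<open>x\<close> of the graph being blown up, and \<open>New e i\<close>
  is the \<open>i\<close>-th vertex added for its edge \<open>e\<close>. The tag \<open>Old\<close> is needed because an edge \<open>e\<close>
  survives the step and receives fresh vertices again in the next one. Edges are stored as
  finite sets (type \<open>fset\<close>) since a datatype cannot recurse through \<open>set\<close>.
\<close>

datatype 'a cl_vertex = Init 'a | Old "'a cl_vertex" | New "'a cl_vertex fset" nat

definition new_verts :: "nat \<Rightarrow> 'a cl_vertex set \<Rightarrow> 'a cl_vertex set" where
  "new_verts n e = New (Abs_fset e) ` {..<n - 2}"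

definition clique_edges :: "'b set \<Rightarrow> 'b set set" where
  "clique_edges B = {f. f \<subseteq> B \<and> card f = 2}"

definition CL :: "nat \<Rightarrow> 'a cl_vertex ugraph \<Rightarrow> 'a cl_vertex ugraph" where
  "CL n G = \<lparr>
     verts = Old ` verts G \<union> (\<Union>e\<in>edges G. new_verts n e),
     edges = (`) Old ` edges G \<union> (\<Union>e\<in>edges G. clique_edges (Old ` e \<union> new_verts n e)) \<rparr>"

text \<open>The zeroth iterate is \<open>G\<close> itself, with each vertex \<open>v\<close> renamed to \<open>Init v\<close>.\<close>

primrec CL_iter :: "nat \<Rightarrow> nat \<Rightarrow> 'a ugraph \<Rightarrow> 'a cl_vertex ugraph" where
  "CL_iter n 0 G = \<lparr> verts = Init ` verts G, edges = (`) Init ` edges G \<rparr>"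
| "CL_iter n (Suc r) G = CL n (CL_iter n r G)"

lemma card_new_verts: "card (new_verts n e) = n - 2"
  unfolding new_verts_def by (subst card_image) (auto simp: inj_on_def)

lemma finite_new_verts: "finite (new_verts n e)"
  by (simp add: new_verts_def)

lemma new_verts_disjoint:
  assumes "finite d" "finite e" "d \<noteq> e"
  shows "new_verts n d \<inter> new_verts n e = {}"
  using assms by (auto simp: new_verts_def Abs_fset_inject)

text \<open>The end-vertices of an edge and its new vertices form a block of \<open>n\<close> vertices.\<close>

lemma card_block:
  assumes "n \<ge> 3" "card e = 2"
  shows "card (Old ` e \<union> new_verts n e) = n"
proof -
  have "finite e" using assms(2) by (metis card.infinite zero_neq_numeral)
  moreover have "card (Old ` e) = 2"
    using assms(2) by (subst card_image) (auto simp: inj_on_def)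
  moreover have "Old ` e \<inter> new_verts n e = {}" by (auto simp: new_verts_def)
  ultimately have "card (Old ` e \<union> new_verts n e) = 2 + (n - 2)"
    by (simp add: card_Un_disjoint card_new_verts finite_new_verts)
  then show ?thesis using assms(1) by simp
qed

lemma finite_simple_graph_CL:
  assumes "finite_simple_graph G"
  shows "finite_simple_graph (CL n G)"
proof -
  have "edges G \<subseteq> Pow (verts G)" "finite (verts G)"
    using assms by (auto simp: finite_simple_graph_def)
  then have "finite (edges G)" by (meson finite_Pow_iff finite_subset)
  moreover have "card (Old ` e) = 2" if "card e = 2" for e :: "'a cl_vertex set"
    using that by (subst card_image) (auto simp: inj_on_def)
  ultimately show ?thesis
    using assms
    by (auto simp: finite_simple_graph_def CL_def finite_new_verts clique_edges_def subset_iff)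
qed

end

theory Submission
  imports Defs "HOL-Library.FuncSet"
begin

text \<open>
  Blowing up replaces every edge \<open>e\<close> of a graph by a complete graph \<open>K\<^sub>n\<close> that meets the rest
  of the graph only in the two ends of \<open>e\<close>. A spanning tree of the blow-up therefore restricts,
  on every such block, either to a spanning tree of \<open>K\<^sub>n\<close> or to a spanning forest with two
  components, one at each end of \<open>e\<close>; the edges \<open>e\<close> of the first kind form a spanning tree of the
  original graph, and conversely any local choices of this shape fit together. There are
  \<open>n ^ (n - 2)\<close> trees and \<open>2 * n ^ (n - 3)\<close> separating forests on a block, and a graph with \<open>N\<close>
  vertices has \<open>N - 1\<close> edges in each spanning tree, so one blow-up of a graph with \<open>N\<close> vertices and
  \<open>E\<close> edges multiplies \<open>\<tau>\<close> by \<open>(n ^ (n - 2)) ^ (N - 1) * (2 * n ^ (n - 3)) ^ (E - (N - 1))\<close>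
  (\<open>num_spanning_trees_CL\<close>). The edge counts of the iterates are in geometric progression with
  ratio \<open>n * (n - 1) / 2\<close>, each step adds \<open>n - 2\<close> vertices per edge, and adding
  up the exponents over \<open>r\<close> steps gives the formula; the number \<open>\<alpha>\<close> is half of the sum of the powers of that ratio below the \<open>r\<close>-th.

  Trees are handled as parent functions. After a root \<open>\<rho>\<close> is chosen, a spanning tree is
  the same as a function that sends each other vertex to a neighbour and reaches \<open>\<rho>\<close> from
  everywhere (\<open>num_spanning_trees_eq_card_arborescences\<close>). In this form both block counts are instances
  of one formula for rooted forests (\<open>card_acyclic_maps\<close>), with one and with two roots, and the
  decomposition into blocks is restriction of a function to the pieces of a partition of its
  domain. The one global condition is well-foundedness; \<open>wf_step_rel_CL_iff\<close> shows that it
  splits into well-foundedness of the parent function on the original graph and of each local piece.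
\<close>

section \<open>Counting rooted forests on a fixed set of roots\<close>

text \<open>
  A pair consists of a parent and its child in that order, so that well-founded induction proceeds from
  the roots to their descendants.
\<close>
definition step_rel :: "('a \<Rightarrow> 'a) \<Rightarrow> 'a set \<Rightarrow> ('a \<times> 'a) set" where
  "step_rel h D = (\<lambda>x. (h x, x)) ` D"

lemma in_step_rel_iff: "(y, x) \<in> step_rel h D \<longleftrightarrow> x \<in> D \<and> y = h x"
  by (auto simp: step_rel_def)

lemma step_relI: "x \<in> D \<Longrightarrow> (h x, x) \<in> step_rel h D"
  by (simp add: in_step_rel_iff)

text \<open>
  These are the forests on \<open>B\<close> whose set of roots is \<open>B - D\<close>, each given by its parent function;
  well-foundedness says that iterating the parent function from any vertex leaves \<open>D\<close>.
\<close>
definition acyclic_maps :: "'a set \<Rightarrow> 'a set \<Rightarrow> ('a \<Rightarrow> 'a) set" where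
  "acyclic_maps D B = {h \<in> D \<rightarrow>\<^sub>E B. wf (step_rel h D)}"

lemma finite_acyclic_maps: "finite D \<Longrightarrow> finite B \<Longrightarrow> finite (acyclic_maps D B)"
  by (simp add: acyclic_maps_def finite_PiE)

lemma step_rel_neq: "wf (step_rel h D) \<Longrightarrow> x \<in> D \<Longrightarrow> h x \<noteq> x"
  using wf_not_refl[of "step_rel h D" x] by (auto simp: in_step_rel_iff)

lemma step_rel_no_swap: "wf (step_rel h D) \<Longrightarrow> x \<in> D \<Longrightarrow> h x \<in> D \<Longrightarrow> h (h x) \<noteq> x"
  using wf_not_sym[of "step_rel h D" x "h x"] by (auto simp: in_step_rel_iff)

lemma acyclic_maps_no_root:
  assumes "D \<noteq> {}"
  shows "acyclic_maps D D = {}"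
proof -
  have False if h: "h \<in> D \<rightarrow>\<^sub>E D" and wf: "wf (step_rel h D)" for h
  proof -
    obtain x where "x \<in> D" "\<forall>y. (y, x) \<in> step_rel h D \<longrightarrow> y \<notin> D"
      using assms wfE_min'[OF wf, of D] by metis
    then show False using PiE_mem[OF h] by (simp add: in_step_rel_iff)
  qed
  then show ?thesis unfolding acyclic_maps_def by blast
qed

text \<open>
  A path of parents that enters \<open>J\<close> leaves \<open>D\<close> at the next step, so only the steps taken
  outside \<open>J\<close> can obstruct termination.
\<close>
lemma wf_step_rel_extend:
  assumes wf: "wf (step_rel h (D - J))" and out: "\<And>x. x \<in> J \<Longrightarrow> h x \<notin> D"
  shows "wf (step_rel h D)"
proof -
  have acc: "x \<in> Wellfounded.acc (step_rel h D)" if "x \<notin> D" for x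
    by (rule accI) (use that in \<open>simp add: in_step_rel_iff\<close>)
  have "x \<in> Wellfounded.acc (step_rel h D)" for x
  proof (induction x rule: wf_induct_rule[OF wf])
    case (1 x)
    show ?case
    proof (rule accI)
      fix y assume "(y, x) \<in> step_rel h D"
      then have y: "x \<in> D" "y = h x" by (auto simp: in_step_rel_iff)
      show "y \<in> Wellfounded.acc (step_rel h D)"
      proof (cases "x \<in> J")
        case True
        then show ?thesis using acc[OF out] y(2) by simp
      next
        case False
        then show ?thesis using y by (intro 1) (simp add: in_step_rel_iff)
      qed
    qed
  qed
  then show ?thesis unfolding wf_iff_acc by blast
qed

lemma step_rel_cong: "(\<And>x. x \<in> D \<Longrightarrow> g x = h x) \<Longrightarrow> step_rel g D = step_rel h D"
  by (auto simp: step_rel_def)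

lemma step_rel_mono: "D \<subseteq> D' \<Longrightarrow> step_rel h D \<subseteq> step_rel h D'"
  by (auto simp: step_rel_def)

text \<open>
  Let \<open>J\<close> be the set of vertices whose parent is a root. Their parents can be chosen freely among
  the roots, and deleting the roots leaves an arbitrary forest on \<open>D\<close> rooted at \<open>J\<close>.
\<close>
lemma card_acyclic_maps_first_layer:
  assumes "D \<subseteq> B" "J \<subseteq> D" "finite B"
  shows "card {h \<in> acyclic_maps D B. {x \<in> D. h x \<notin> D} = J}
    = card (B - D) ^ card J * card (acyclic_maps (D - J) D)"
proof -
  let ?S = "{h \<in> acyclic_maps D B. {x \<in> D. h x \<notin> D} = J}"
  let ?f = "\<lambda>h. (restrict h J, restrict h (D - J))"
  let ?g = "\<lambda>(a, b) x. if x \<in> J then a x else b x"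
  have "bij_betw ?f ?S ((J \<rightarrow>\<^sub>E B - D) \<times> acyclic_maps (D - J) D)"
  proof (rule bij_betw_byWitness[where f' = ?g])
    show "\<forall>h\<in>?S. ?g (?f h) = h"
    proof
      fix h assume "h \<in> ?S"
      then have "h x = undefined" if "x \<notin> D" for x
        using that unfolding acyclic_maps_def by (blast intro: PiE_arb)
      then show "?g (?f h) = h" using assms(2) by (auto simp: fun_eq_iff)
    qed
    show "\<forall>p\<in>(J \<rightarrow>\<^sub>E B - D) \<times> acyclic_maps (D - J) D. ?f (?g p) = p"
    proof
      fix p assume "p \<in> (J \<rightarrow>\<^sub>E B - D) \<times> acyclic_maps (D - J) D"
      then obtain a b where p: "p = (a, b)" and "a \<in> J \<rightarrow>\<^sub>E B - D" "b \<in> acyclic_maps (D - J) D"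
        by blast
      then have "\<And>x. x \<notin> J \<Longrightarrow> a x = undefined" "\<And>x. x \<notin> D - J \<Longrightarrow> b x = undefined"
        unfolding acyclic_maps_def by (blast intro: PiE_arb)+
      then show "?f (?g p) = p" by (auto simp: p fun_eq_iff restrict_def)
    qed
    show "?f ` ?S \<subseteq> (J \<rightarrow>\<^sub>E B - D) \<times> acyclic_maps (D - J) D"
    proof (rule image_subsetI)
      fix h assume "h \<in> ?S"
      then have h: "h \<in> acyclic_maps D B" and J: "J = {x \<in> D. h x \<notin> D}" by auto
      have h': "h \<in> D \<rightarrow>\<^sub>E B" "wf (step_rel h D)" using h by (simp_all add: acyclic_maps_def)
      have "wf (step_rel h (D - J))"
        by (rule wf_subset[OF h'(2) step_rel_mono]) blast
      moreover have "step_rel (restrict h (D - J)) (D - J) = step_rel h (D - J)"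
        by (rule step_rel_cong) simp
      ultimately have "restrict h (D - J) \<in> acyclic_maps (D - J) D"
        using J by (simp add: acyclic_maps_def)
      moreover have "restrict h J \<in> J \<rightarrow>\<^sub>E B - D"
        using PiE_mem[OF h'(1)] J by auto
      ultimately show "?f h \<in> (J \<rightarrow>\<^sub>E B - D) \<times> acyclic_maps (D - J) D"
        by simp
    qed
    show "?g ` ((J \<rightarrow>\<^sub>E B - D) \<times> acyclic_maps (D - J) D) \<subseteq> ?S"
    proof (rule image_subsetI)
      fix p assume "p \<in> (J \<rightarrow>\<^sub>E B - D) \<times> acyclic_maps (D - J) D"
      then obtain a b where p: "p = (a, b)" and a: "a \<in> J \<rightarrow>\<^sub>E B - D"
        and b: "b \<in> acyclic_maps (D - J) D"
        by blast
      define h where "h = (\<lambda>x. if x \<in> J then a x else b x)"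
      have hJ: "h x \<in> B - D" if "x \<in> J" for x using PiE_mem[OF a that] that by (simp add: h_def)
      have hD: "h x \<in> D" if "x \<in> D - J" for x
        using PiE_mem[of b "D - J" "\<lambda>_. D"] b that by (simp add: h_def acyclic_maps_def)
      have "step_rel h (D - J) = step_rel b (D - J)"
        by (rule step_rel_cong) (simp add: h_def)
      then have "wf (step_rel h (D - J))" using b by (simp add: acyclic_maps_def)
      then have "wf (step_rel h D)" by (rule wf_step_rel_extend) (use hJ in blast)
      moreover have "h \<in> D \<rightarrow>\<^sub>E B"
      proof (rule PiE_I)
        show "h x \<in> B" if "x \<in> D" for x using hJ hD that assms(1) by (cases "x \<in> J") auto
        show "h x = undefined" if "x \<notin> D" for x
          using PiE_arb[of b "D - J" "\<lambda>_. D" x] b that assms(2)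
          by (auto simp: h_def acyclic_maps_def)
      qed
      moreover have "{x \<in> D. h x \<notin> D} = J" using hJ hD assms(2) by blast
      ultimately have "h \<in> ?S" by (simp add: acyclic_maps_def)
      then show "?g p \<in> ?S" by (simp add: p h_def)
    qed
  qed
  then have "card ?S = card ((J \<rightarrow>\<^sub>E B - D) \<times> acyclic_maps (D - J) D)"
    by (rule bij_betw_same_card)
  moreover have "finite J" using assms by (meson finite_subset)
  ultimately show ?thesis
    by (simp only: card_cartesian_product card_PiE prod_constant)
qed

text \<open>
  The absorption identity for binomial coefficients turns the factor \<open>card J\<close> into \<open>Suc m\<close> and
  lowers the binomial theorem by one degree.
\<close>
lemma sum_card_mult_subsets:
  fixes k m :: nat
  assumes "finite D" "card D = Suc m"
  shows "(\<Sum>J\<in>Pow D. card J * k ^ card J * l ^ (card D - card J)) = Suc m * k * (k + l) ^ m"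
proof -
  have "(\<Sum>J\<in>Pow D. card J * k ^ card J * l ^ (card D - card J))
     = (\<Sum>j\<in>{..Suc m}. \<Sum>J\<in>{J \<in> Pow D. card J = j}.
          card J * k ^ card J * l ^ (card D - card J))"
  proof (rule sum.group[symmetric])
    show "card ` Pow D \<subseteq> {..Suc m}" using card_mono[OF assms(1)] assms(2) by fastforce
  qed (use assms(1) in simp_all)
  also have "\<dots> = (\<Sum>j\<in>{..Suc m}. (Suc m choose j) * (j * k ^ j * l ^ (Suc m - j)))"
  proof (rule sum.cong[OF refl])
    fix j
    have "{J \<in> Pow D. card J = j} = {J. J \<subseteq> D \<and> card J = j}" by auto
    then show "(\<Sum>J\<in>{J \<in> Pow D. card J = j}. card J * k ^ card J * l ^ (card D - card J))
      = (Suc m choose j) * (j * k ^ j * l ^ (Suc m - j))"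
      using n_subsets[OF assms(1), of j] assms(2) by simp
  qed
  also have "\<dots> = (\<Sum>i\<le>m. (Suc m choose Suc i) * (Suc i * k ^ Suc i * l ^ (m - i)))"
    by (subst sum.atMost_Suc_shift) simp
  also have "\<dots> = (\<Sum>i\<le>m. Suc m * k * ((m choose i) * k ^ i * l ^ (m - i)))"
  proof (rule sum.cong[OF refl])
    fix i
    have "(Suc m choose Suc i) * (Suc i * k ^ Suc i * l ^ (m - i))
      = (Suc i * (Suc m choose Suc i)) * (k ^ Suc i * l ^ (m - i))" by (simp only: mult_ac)
    also have "\<dots> = Suc m * k * ((m choose i) * k ^ i * l ^ (m - i))"
      by (subst Suc_times_binomial) (simp add: algebra_simps)
    finally show "(Suc m choose Suc i) * (Suc i * k ^ Suc i * l ^ (m - i))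
      = Suc m * k * ((m choose i) * k ^ i * l ^ (m - i))" .
  qed
  also have "\<dots> = Suc m * k * (k + l) ^ m"
    by (subst binomial) (simp add: sum_distrib_left)
  finally show ?thesis .
qed

text \<open>
  With \<open>k\<close> roots among \<open>l > k\<close> vertices this is the classical count \<open>k * l ^ (l - k - 1)\<close> of rooted
  forests, which for \<open>k = 1\<close> is Cayley's formula. Multiplying by \<open>card B\<close> keeps the exponent
  natural when \<open>D\<close> is empty. The induction sums over the possible first layers \<open>J\<close>, each of which
  leaves a forest problem with \<open>J\<close> as its roots.
\<close>
lemma card_acyclic_maps:
  assumes "finite B" "D \<subseteq> B"
  shows "card (acyclic_maps D B) * card B = card (B - D) * card B ^ card D"
  using assms
proof (induction "card D" arbitrary: D B rule: less_induct)
  case less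
  have finD: "finite D" using less.prems finite_subset by blast
  show ?case
  proof (cases "card D")
    case 0
    then have "D = {}" using finD by simp
    then have "acyclic_maps D B = {\<lambda>x. undefined}" by (auto simp: acyclic_maps_def step_rel_def)
    then show ?thesis using \<open>D = {}\<close> by simp
  next
    case (Suc m)
    define k where "k = card (B - D)"
    have cB: "card B = k + Suc m"
      using less.prems Suc finD unfolding k_def
      by (metis card_Diff_subset card_mono le_add_diff_inverse2)
    have IH: "card (acyclic_maps (D - J) D) * Suc m = card J * Suc m ^ (card D - card J)"
      if "J \<subseteq> D" for J
    \<comment> \<open>An empty \<open>J\<close> does not shrink the problem; then there is no forest at all, as no path can
      leave \<open>D\<close>.\<close>
    proof (cases "J = {}")
      case True
      then show ?thesis using acyclic_maps_no_root[of D] Suc by (cases "D = {}") auto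
    next
      case False
      have c: "card (D - J) = card D - card J" "D - (D - J) = J"
        using that finD by (auto intro: card_Diff_subset finite_subset)
      have "card J > 0" using False that finD finite_subset by (auto simp: card_gt_0_iff)
      then have "card (D - J) < card D" using c(1) Suc by linarith
      from less.hyps[OF this finD Diff_subset] show ?thesis unfolding c Suc .
    qed
    have "acyclic_maps D B = (\<Union>J\<in>Pow D. {h \<in> acyclic_maps D B. {x \<in> D. h x \<notin> D} = J})"
      (is "_ = ?U")
    proof
      show "acyclic_maps D B \<subseteq> ?U"
      proof
        fix h assume "h \<in> acyclic_maps D B"
        then show "h \<in> ?U" by (intro UN_I[of "{x \<in> D. h x \<notin> D}"]) simp_all
      qed
    qed auto
    from arg_cong[OF this, of card] have "card (acyclic_maps D B) = card ?U" .
    also have "\<dots> = (\<Sum>J\<in>Pow D. card {h \<in> acyclic_maps D B. {x \<in> D. h x \<notin> D} = J})"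
    proof (rule card_UN_disjoint)
      show "\<forall>J\<in>Pow D. finite {h \<in> acyclic_maps D B. {x \<in> D. h x \<notin> D} = J}"
        using finite_acyclic_maps[OF finD less.prems(1)] by simp
    qed (use finD in auto)
    also have "\<dots> = (\<Sum>J\<in>Pow D. k ^ card J * card (acyclic_maps (D - J) D))"
      using less.prems by (intro sum.cong) (auto simp: card_acyclic_maps_first_layer k_def)
    finally have "card (acyclic_maps D B) * Suc m
        = (\<Sum>J\<in>Pow D. k ^ card J * (card (acyclic_maps (D - J) D) * Suc m))"
      by (simp only: sum_distrib_right mult.assoc)
    also have "\<dots> = (\<Sum>J\<in>Pow D. card J * k ^ card J * Suc m ^ (card D - card J))"
      by (intro sum.cong) (auto simp: IH simp del: mult_Suc_right)
    also have "\<dots> = Suc m * k * (k + Suc m) ^ m"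
      by (rule sum_card_mult_subsets[OF finD Suc])
    finally have "Suc m * card (acyclic_maps D B) = Suc m * (k * (k + Suc m) ^ m)"
      by (simp only: mult_ac)
    then have "card (acyclic_maps D B) = k * (k + Suc m) ^ m"
      using nat_mult_eq_cancel_disj by blast
    then show ?thesis by (simp add: cB Suc algebra_simps flip: k_def)
  qed
qed

section \<open>Spanning trees as parent functions\<close>

definition parent_edges :: "('a \<Rightarrow> 'a) \<Rightarrow> 'a set \<Rightarrow> 'a set set" where
  "parent_edges q D = (\<lambda>u. {u, q u}) ` D"

definition arborescences :: "'a ugraph \<Rightarrow> 'a \<Rightarrow> ('a \<Rightarrow> 'a) set" where
  "arborescences G \<rho> =
     {q \<in> acyclic_maps (verts G - {\<rho>}) (verts G). parent_edges q (verts G - {\<rho>}) \<subseteq> edges G}"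

lemma arborescencesD:
  assumes "q \<in> arborescences G \<rho>"
  shows "wf (step_rel q (verts G - {\<rho>}))"
    and "u \<in> verts G \<Longrightarrow> u \<noteq> \<rho> \<Longrightarrow> q u \<in> verts G"
    and "u \<in> verts G \<Longrightarrow> u \<noteq> \<rho> \<Longrightarrow> {u, q u} \<in> edges G"
    and "\<not> (u \<in> verts G \<and> u \<noteq> \<rho>) \<Longrightarrow> q u = undefined"
  using assms PiE_mem[of q "verts G - {\<rho>}" "\<lambda>_. verts G" u]
    PiE_arb[of q "verts G - {\<rho>}" "\<lambda>_. verts G" u]
  by (auto simp: arborescences_def acyclic_maps_def parent_edges_def)

text \<open>
  Two vertices with the same parent edge would be each other's parents. Hence a spanning tree has one
  edge for each vertex other than the root.
\<close>
lemma inj_on_parent_edge: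
  assumes "wf (step_rel q D)"
  shows "inj_on (\<lambda>u. {u, q u}) D"
proof (rule inj_onI, rule ccontr)
  fix u v assume uv: "u \<in> D" "v \<in> D" "{u, q u} = {v, q v}" "u \<noteq> v"
  then have "q u = v" "q v = u" by (auto simp: doubleton_eq_iff)
  then show False using step_rel_no_swap[OF assms uv(1)] uv(2) by simp
qed

text \<open>
  On a cycle, pick a vertex \<open>x\<close> that is nobody's parent among the vertices of the cycle. Both of its
  cycle edges must then be its own parent edge, so its two neighbours on the cycle coincide.
\<close>
lemma parent_edges_no_cycle:
  assumes "finite D" "wf (step_rel q D)" "edges T = parent_edges q D"
  shows "\<not> graph_cycle T c"
proof
  assume cyc: "graph_cycle T c"
  define L where "L = length c"
  have L: "3 \<le> L" and dist: "distinct c"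
    and edge: "\<And>i. i < L \<Longrightarrow> {c ! i, c ! (Suc i mod L)} \<in> parent_edges q D"
    using cyc by (auto simp: graph_cycle_def L_def assms(3))
  have "finite (step_rel q D)" using assms(1) by (simp add: step_rel_def)
  then have "wf ((step_rel q D)\<inverse>)"
    using assms(2) by (simp add: finite_acyclic_wf_converse wf_acyclic)
  moreover have "set c \<noteq> {}" using L unfolding L_def by auto
  ultimately obtain x where "x \<in> set c" and max: "\<And>y. (y, x) \<in> (step_rel q D)\<inverse> \<Longrightarrow> y \<notin> set c"
    using wfE_min' by metis
  have parent: "a = q x" if "{x, a} \<in> parent_edges q D" "a \<in> set c" for a
  proof -
    obtain u where "u \<in> D" "{x, a} = {u, q u}" using \<open>{x, a} \<in> _\<close> by (auto simp: parent_edges_def)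
    moreover have "\<not> (a \<in> D \<and> x = q a)" using max[of a] that(2) by (auto simp: in_step_rel_iff)
    ultimately show ?thesis by (auto simp: doubleton_eq_iff)
  qed
  obtain i where i: "i < L" "c ! i = x" using \<open>x \<in> set c\<close> by (auto simp: in_set_conv_nth L_def)
  \<comment> \<open>the cyclic successor and predecessor of the position of \<open>x\<close>\<close>
  define j where "j = (if Suc i = L then 0 else Suc i)"
  define k where "k = (if i = 0 then L - 1 else i - 1)"
  have jk: "j < L" "k < L" "j \<noteq> k" "Suc i mod L = j" "Suc k mod L = i"
    using i L by (auto simp: j_def k_def)
  have "c ! j = q x" using parent[of "c ! j"] edge[OF i(1)] jk i by (simp add: L_def)
  moreover have "c ! k = q x"
    using parent[of "c ! k"] edge[OF jk(2)] jk i by (simp add: L_def insert_commute)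
  ultimately show False using nth_eq_iff_index_eq[OF dist, of j k] jk by (simp add: L_def)
qed

lemma parent_edges_connected:
  assumes "wf (step_rel q (V - {\<rho>}))" "\<And>u. u \<in> V - {\<rho>} \<Longrightarrow> q u \<in> V" "\<rho> \<in> V"
  shows "connected_graph \<lparr>verts = V, edges = parent_edges q (V - {\<rho>})\<rparr>"
proof -
  let ?T = "\<lparr>verts = V, edges = parent_edges q (V - {\<rho>})\<rparr>"
  have to_root: "u \<in> V \<longrightarrow> (u, \<rho>) \<in> (adj_rel ?T)\<^sup>*" for u
  proof (induction u rule: wf_induct_rule[OF assms(1)])
    case (1 u)
    show ?case
    proof
      assume u: "u \<in> V"
      show "(u, \<rho>) \<in> (adj_rel ?T)\<^sup>*"
      proof (cases "u = \<rho>")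
        case False
        then have "(q u, \<rho>) \<in> (adj_rel ?T)\<^sup>*" using 1[of "q u"] u assms(2) by (simp add: in_step_rel_iff)
        moreover have "(u, q u) \<in> adj_rel ?T" using u False by (auto simp: adj_rel_def parent_edges_def)
        ultimately show ?thesis by (rule converse_rtrancl_into_rtrancl[rotated])
      qed simp
    qed
  qed
  have "sym ((adj_rel ?T)\<^sup>*)"
    by (intro sym_rtrancl symI) (simp add: adj_rel_def insert_commute)
  then have "(u, v) \<in> (adj_rel ?T)\<^sup>*" if "u \<in> V" "v \<in> V" for u v
    using to_root that by (meson symD rtrancl_trans)
  then show ?thesis using assms(3) by (auto simp: connected_graph_def)
qed

lemma spanning_tree_of_arborescence:
  assumes G: "finite_simple_graph G" and "\<rho> \<in> verts G" and q: "q \<in> arborescences G \<rho>"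
  shows "spanning_tree \<lparr>verts = verts G, edges = parent_edges q (verts G - {\<rho>})\<rparr> G"
proof -
  let ?P = "parent_edges q (verts G - {\<rho>})"
  have P: "?P \<subseteq> edges G" using q by (simp add: arborescences_def)
  have "finite_simple_graph \<lparr>verts = verts G, edges = ?P\<rparr>"
    using G P by (auto simp: finite_simple_graph_def)
  moreover have "connected_graph \<lparr>verts = verts G, edges = ?P\<rparr>"
    using arborescencesD[OF q] assms(2) by (intro parent_edges_connected) auto
  moreover have "\<not> graph_cycle \<lparr>verts = verts G, edges = ?P\<rparr> c" for c
    using G arborescencesD(1)[OF q] by (intro parent_edges_no_cycle) (auto simp: finite_simple_graph_def)
  ultimately show ?thesis using P by (simp add: spanning_tree_def tree_def)
qed

text \<open>
  By induction from the root outwards: the edge \<open>{u, q u}\<close> must be a parent edge for \<open>q'\<close> as well,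
  and if it belonged to \<open>q u\<close> rather than to \<open>u\<close>, then \<open>q'\<close> and hence, by induction, \<open>q\<close> would
  send \<open>q u\<close> back to \<open>u\<close>.
\<close>
lemma parent_edges_inject:
  assumes q: "q \<in> arborescences G \<rho>" and q': "q' \<in> arborescences G \<rho>"
    and eq: "parent_edges q (verts G - {\<rho>}) = parent_edges q' (verts G - {\<rho>})"
  shows "q = q'"
proof
  fix u
  have wf: "wf (step_rel q (verts G - {\<rho>}))" using q by (rule arborescencesD)
  show "q u = q' u"
  proof (induction u rule: wf_induct_rule[OF wf])
    case (1 u)
    show ?case
    proof (cases "u \<in> verts G - {\<rho>}")
      case True
      then have "{u, q u} \<in> parent_edges q' (verts G - {\<rho>})"
        unfolding eq[symmetric] by (simp add: parent_edges_def)
      then obtain v where v: "v \<in> verts G - {\<rho>}" "{u, q u} = {v, q' v}"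
        by (auto simp: parent_edges_def)
      show ?thesis
      proof (cases "v = u")
        case True
        then show ?thesis using v by (auto simp: doubleton_eq_iff)
      next
        case False
        then have "v = q u" "q' v = u" using v(2) by (auto simp: doubleton_eq_iff)
        then have "q (q u) = u" using 1[of v] True by (simp add: in_step_rel_iff)
        then show ?thesis using step_rel_no_swap[OF wf True] v(1) \<open>v = q u\<close> by simp
      qed
    next
      case False
      then show ?thesis using arborescencesD(4)[OF q, of u] arborescencesD(4)[OF q', of u] by simp
    qed
  qed
qed

lemma rtrancl_distinct_path:
  assumes "(x, y) \<in> r\<^sup>*"
  shows "\<exists>c. c \<noteq> [] \<and> distinct c \<and> hd c = x \<and> last c = y \<and> successively (\<lambda>a b. (a, b) \<in> r) c"
  using assms
proof (induction rule: converse_rtrancl_induct)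
  case base
  show ?case by (rule exI[of _ "[y]"]) simp
next
  case (step x z)
  then obtain c where c: "c \<noteq> []" "distinct c" "hd c = z" "last c = y"
    "successively (\<lambda>a b. (a, b) \<in> r) c" by blast
  show ?case
  proof (cases "x \<in> set c")
    case True
    then obtain as bs where "c = as @ x # bs" by (meson split_list)
    then show ?thesis using c
      by (intro exI[of _ "x # bs"]) (auto simp: successively_append_iff)
  next
    case False
    then show ?thesis using c step(1)
      by (intro exI[of _ "x # c"]) (auto simp: successively_Cons)
  qed
qed

text \<open>
  A further edge would close a cycle with a path that joins its ends in the connected subgraph.
\<close>
lemma edges_of_acyclic_supergraph:
  assumes conn: "connected_graph S" and sub: "edges S \<subseteq> edges T" "verts S = verts T"
    and simple: "finite_simple_graph T" and no_cycle: "\<nexists>c. graph_cycle T c"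
  shows "edges S = edges T"
proof (rule ccontr)
  assume "edges S \<noteq> edges T"
  then obtain e where e: "e \<in> edges T" "e \<notin> edges S" using sub(1) by blast
  then have "card e = 2" "e \<subseteq> verts T" using simple by (auto simp: finite_simple_graph_def)
  then obtain x y where xy: "e = {x, y}" "x \<noteq> y" by (auto simp: card_2_iff)
  have "(x, y) \<in> (adj_rel S)\<^sup>*"
    using conn \<open>e \<subseteq> verts T\<close> xy sub(2) by (simp add: connected_graph_def)
  from rtrancl_distinct_path[OF this] obtain c where c: "c \<noteq> []" "distinct c" "hd c = x" "last c = y"
    and path: "successively (\<lambda>a b. (a, b) \<in> adj_rel S) c" by blast
  have step: "{c ! i, c ! Suc i} \<in> edges S" if "Suc i < length c" for i
    using path that by (simp add: successively_conv_nth adj_rel_def)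
  have xy_nth: "c ! 0 = x" "c ! (length c - 1) = y"
    using c by (simp_all add: hd_conv_nth last_conv_nth)
  have "length c \<noteq> 1" using xy_nth xy(2) by auto
  moreover have "length c \<noteq> 2" using xy_nth step[of 0] e(2) xy(1) by auto
  moreover have "length c \<noteq> 0" using c(1) by simp
  ultimately have len: "3 \<le> length c" by linarith
  have "{c ! i, c ! (Suc i mod length c)} \<in> edges T" if i: "i < length c" for i
  proof (cases "Suc i = length c")
    case True
    then have "i = length c - 1" by simp
    then show ?thesis using True xy_nth e(1) xy(1) by (simp add: insert_commute)
  next
    case False
    then show ?thesis using step[of i] i sub(1) by auto
  qed
  then have "graph_cycle T c" using len c(2) by (simp add: graph_cycle_def)
  then show False using no_cycle by blast
qed

text \<open>
  The function \<open>d\<close> is the distance to \<open>\<rho>\<close>. Stepping to closer neighbours is how a tree is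
  turned into a parent function, the distance being the termination measure.
\<close>
lemma connected_graph_closer_neighbour:
  assumes simple: "finite_simple_graph T" and conn: "connected_graph T" and "\<rho> \<in> verts T"
  obtains d :: "'a \<Rightarrow> nat" where
    "\<And>u. u \<in> verts T - {\<rho>} \<Longrightarrow> \<exists>w\<in>verts T. {u, w} \<in> edges T \<and> d w < d u"
proof
  define d where "d u = (LEAST k. (u, \<rho>) \<in> adj_rel T ^^ k)" for u
  fix u assume u: "u \<in> verts T - {\<rho>}"
  then have "(u, \<rho>) \<in> (adj_rel T)\<^sup>*" using conn assms(3) by (simp add: connected_graph_def)
  then obtain k where "(u, \<rho>) \<in> adj_rel T ^^ k" by (auto simp: rtrancl_power)
  then have d: "(u, \<rho>) \<in> adj_rel T ^^ d u" unfolding d_def by (rule LeastI)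
  then obtain m where m: "d u = Suc m" using u by (cases "d u") auto
  then obtain w where w: "(u, w) \<in> adj_rel T" "(w, \<rho>) \<in> adj_rel T ^^ m"
    using d unfolding m by (blast elim: relpow_Suc_E2)
  have "d w \<le> m" unfolding d_def by (rule Least_le) (rule w)
  moreover have "w \<in> verts T" using w(1) simple by (auto simp: adj_rel_def finite_simple_graph_def)
  ultimately show "\<exists>w\<in>verts T. {u, w} \<in> edges T \<and> d w < d u"
    using w(1) m by (auto simp: adj_rel_def)
qed

lemma arborescence_of_spanning_tree:
  assumes T: "spanning_tree T G" and \<rho>: "\<rho> \<in> verts G"
  obtains q where "q \<in> arborescences G \<rho>" "edges T = parent_edges q (verts G - {\<rho>})"
proof -
  let ?D = "verts G - {\<rho>}"
  have V: "verts T = verts G" and E: "edges T \<subseteq> edges G" and simple: "finite_simple_graph T"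
    and conn: "connected_graph T" and no_cycle: "\<nexists>c. graph_cycle T c"
    using T by (simp_all add: spanning_tree_def tree_def)
  obtain d :: "'a \<Rightarrow> nat" where
    "\<And>u. u \<in> ?D \<Longrightarrow> \<exists>w\<in>verts G. {u, w} \<in> edges T \<and> d w < d u"
    using connected_graph_closer_neighbour[OF simple conn] \<rho> unfolding V by blast
  then obtain p where p: "\<And>u. u \<in> ?D \<Longrightarrow> p u \<in> verts G \<and> {u, p u} \<in> edges T \<and> d (p u) < d u"
    by metis
  define q where "q = restrict p ?D"
  have "step_rel q ?D \<subseteq> measure d" using p by (auto simp: in_step_rel_iff q_def)
  then have wf: "wf (step_rel q ?D)" using wf_subset wf_measure by blast
  have PE: "parent_edges q ?D \<subseteq> edges T" using p by (auto simp: parent_edges_def q_def)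
  have "q \<in> acyclic_maps ?D (verts G)" using p wf by (auto simp: acyclic_maps_def q_def)
  then have "q \<in> arborescences G \<rho>" using PE E by (auto simp: arborescences_def)
  moreover have "parent_edges q ?D = edges T"
    using edges_of_acyclic_supergraph[of "\<lparr>verts = verts G, edges = parent_edges q ?D\<rparr>" T]
      parent_edges_connected[OF wf _ \<rho>] p PE V simple no_cycle by (simp add: q_def)
  ultimately show thesis using that by metis
qed

text \<open>
  The choice of root is immaterial, since the parent edges of an arborescence form a tree on all of
  the vertices and every spanning tree has a unique orientation towards \<open>\<rho>\<close>.
\<close>
theorem num_spanning_trees_eq_card_arborescences:
  assumes G: "finite_simple_graph G" and \<rho>: "\<rho> \<in> verts G"
  shows "\<tau> G = card (arborescences G \<rho>)"
proof -
  let ?t = "\<lambda>q. \<lparr>verts = verts G, edges = parent_edges q (verts G - {\<rho>})\<rparr>"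
  have "bij_betw ?t (arborescences G \<rho>) {T. spanning_tree T G}"
  proof (rule bij_betw_imageI)
    show "inj_on ?t (arborescences G \<rho>)"
      by (rule inj_onI) (auto intro: parent_edges_inject)
    show "?t ` arborescences G \<rho> = {T. spanning_tree T G}"
    proof
      show "?t ` arborescences G \<rho> \<subseteq> {T. spanning_tree T G}"
        using spanning_tree_of_arborescence[OF G \<rho>] by auto
      show "{T. spanning_tree T G} \<subseteq> ?t ` arborescences G \<rho>"
      proof
        fix T assume "T \<in> {T. spanning_tree T G}"
        then have T: "spanning_tree T G" by simp
        then obtain q where q: "q \<in> arborescences G \<rho>" "edges T = parent_edges q (verts G - {\<rho>})"
          using arborescence_of_spanning_tree[OF _ \<rho>] by metis
        then have "T = ?t q" using T by (simp add: spanning_tree_def)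
        then show "T \<in> ?t ` arborescences G \<rho>" using q(1) by blast
      qed
    qed
  qed
  then show ?thesis unfolding num_spanning_trees_def by (rule bij_betw_same_card[symmetric])
qed

section \<open>Spanning trees of one clique blow-up\<close>

text \<open>
  A function on a disjoint union is a free choice of its restrictions to the parts.
\<close>
lemma card_glued_functions:
  assumes fin: "finite I"
    and disj: "\<And>i j. i \<in> I \<Longrightarrow> j \<in> I \<Longrightarrow> i \<noteq> j \<Longrightarrow> D i \<inter> D j = {}"
    and ext: "\<And>i. i \<in> I \<Longrightarrow> F i \<subseteq> extensional (D i)"
  shows "card {p \<in> extensional (\<Union>i\<in>I. D i). \<forall>i\<in>I. restrict p (D i) \<in> F i} = (\<Prod>i\<in>I. card (F i))"
proof -
  let ?S = "{p \<in> extensional (\<Union>i\<in>I. D i). \<forall>i\<in>I. restrict p (D i) \<in> F i}"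
  let ?f = "\<lambda>p. \<lambda>i\<in>I. restrict p (D i)"
  have "bij_betw ?f ?S (Pi\<^sub>E I F)"
  proof (rule bij_betw_imageI)
    show "inj_on ?f ?S"
    proof (rule inj_onI)
      fix p p' assume p: "p \<in> ?S" "p' \<in> ?S" and eq: "?f p = ?f p'"
      show "p = p'"
      proof (rule extensionalityI)
        show "p \<in> extensional (\<Union>i\<in>I. D i)" "p' \<in> extensional (\<Union>i\<in>I. D i)"
          using p by blast+
        fix x assume "x \<in> (\<Union>i\<in>I. D i)"
        then obtain i where i: "i \<in> I" "x \<in> D i" by blast
        then show "p x = p' x" using fun_cong[OF fun_cong[OF eq, of i], of x] by simp
      qed
    qed
    show "?f ` ?S = Pi\<^sub>E I F"
    proof
      show "?f ` ?S \<subseteq> Pi\<^sub>E I F" by (intro image_subsetI restrict_PiE_iff[THEN iffD2]) blast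
      show "Pi\<^sub>E I F \<subseteq> ?f ` ?S"
      proof
        fix h assume h: "h \<in> Pi\<^sub>E I F"
        define idx where "idx x = (SOME i. i \<in> I \<and> x \<in> D i)" for x
        define p where "p = (\<lambda>x\<in>(\<Union>i\<in>I. D i). h (idx x) x)"
        have idx: "idx x = i" if "i \<in> I" "x \<in> D i" for i x
        proof -
          have "idx x \<in> I \<and> x \<in> D (idx x)"
            unfolding idx_def by (rule someI[of _ i]) (use that in simp)
          then show ?thesis using disj[of "idx x" i] that by auto
        qed
        have p: "restrict p (D i) = h i" if "i \<in> I" for i
        proof (rule extensionalityI)
          show "restrict p (D i) \<in> extensional (D i)" by simp
          show "h i \<in> extensional (D i)" using ext[OF that] PiE_mem[OF h that] by blast
          show "restrict p (D i) x = h i x" if x: "x \<in> D i" for x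
            using x \<open>i \<in> I\<close> idx[OF \<open>i \<in> I\<close> x] by (auto simp: p_def)
        qed
        have "p \<in> extensional (\<Union>i\<in>I. D i)" unfolding p_def by (rule restrict_extensional)
        then have "p \<in> ?S" using p PiE_mem[OF h] by simp
        moreover have "h = ?f p"
        proof (rule extensionalityI)
          show "?f p \<in> extensional I" by simp
          show "h \<in> extensional I" using h by (simp add: PiE_def)
          show "h i = ?f p i" if "i \<in> I" for i using that p by simp
        qed
        ultimately show "h \<in> ?f ` ?S" using image_eqI[of h ?f p ?S] by blast
      qed
    qed
  qed
  from bij_betw_same_card[OF this] show ?thesis unfolding card_PiE[OF fin] .
qed

lemma simple_graph_finite:
  assumes "finite_simple_graph G"
  shows "finite (verts G)" and "finite (edges G)"
proof -
  show fin: "finite (verts G)" using assms by (simp add: finite_simple_graph_def)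
  have "edges G \<subseteq> Pow (verts G)" using assms by (auto simp: finite_simple_graph_def)
  then show "finite (edges G)" by (rule finite_subset) (simp add: fin)
qed

lemma simple_graph_edge:
  assumes "finite_simple_graph G" and "e \<in> edges G"
  shows "e \<subseteq> verts G" and "card e = 2" and "finite e"
proof -
  show "e \<subseteq> verts G" "card e = 2" using assms by (auto simp: finite_simple_graph_def)
  then show "finite e" using simple_graph_finite(1)[OF assms(1)] finite_subset by metis
qed

definition block :: "nat \<Rightarrow> 'a cl_vertex set \<Rightarrow> 'a cl_vertex set" where
  "block n e = Old ` e \<union> new_verts n e"

lemma Old_notin_new_verts [simp]: "Old u \<notin> new_verts n e"
  by (auto simp: new_verts_def)

lemma Old_in_block_iff [simp]: "Old u \<in> block n e \<longleftrightarrow> u \<in> e"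
  by (auto simp: block_def)

lemma block_inter:
  assumes "finite d" "finite e" "d \<noteq> e"
  shows "block n d \<inter> block n e = Old ` (d \<inter> e)"
  using new_verts_disjoint[OF assms, of n] by (auto simp: block_def new_verts_def)

text \<open>
  The surviving old edges lie in their own blocks, so the blow-up is a union of cliques.
\<close>
lemma edges_CL:
  assumes "finite_simple_graph G"
  shows "edges (CL n G) = (\<Union>e\<in>edges G. clique_edges (block n e))"
proof -
  have "Old ` e \<in> clique_edges (block n e)" if "e \<in> edges G" for e
  proof -
    have "card (Old ` e) = card e" by (rule card_image) (simp add: inj_on_def)
    then show ?thesis using that assms
      by (auto simp: clique_edges_def block_def finite_simple_graph_def)
  qed
  then show ?thesis by (auto simp: CL_def block_def)
qed

locale blow_up =
  fixes n :: nat and G :: "'a cl_vertex ugraph" and \<rho> :: "'a cl_vertex"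
  assumes n: "3 \<le> n" and simple: "finite_simple_graph G" and root: "\<rho> \<in> verts G"
begin

text \<open>
  For a fixed parent function \<open>q\<close> on \<open>G\<close>, the non-root vertices of the blow-up are distributed over
  the blocks: a new vertex belongs to its only block, and an old vertex \<open>u\<close> to the block of its parent
  edge. A block then misses one of its vertices, the upper end, if its edge is a parent edge, and both
  old vertices otherwise; these missing vertices are the roots inside the block.
\<close>
definition owned :: "('a cl_vertex \<Rightarrow> 'a cl_vertex) \<Rightarrow> 'a cl_vertex set \<Rightarrow> 'a cl_vertex set" where
  "owned q e = new_verts n e \<union> Old ` {u \<in> verts G - {\<rho>}. {u, q u} = e}"

text \<open>
  The parent functions on the blow-up that induce \<open>q\<close>: within each block they form a rooted forest.
\<close>
definition fibre :: "('a cl_vertex \<Rightarrow> 'a cl_vertex) \<Rightarrow> ('a cl_vertex \<Rightarrow> 'a cl_vertex) set" where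
  "fibre q = {p \<in> extensional (verts (CL n G) - {Old \<rho>}).
     \<forall>e\<in>edges G. restrict p (owned q e) \<in> acyclic_maps (owned q e) (block n e)}"

lemmas edge = simple_graph_edge[OF simple]
  and finite_verts = simple_graph_finite(1)[OF simple]
  and finite_edges = simple_graph_finite(2)[OF simple]

lemma new_verts_block_unique:
  assumes "d \<in> edges G" "e \<in> edges G" "x \<in> new_verts n d" "x \<in> block n e"
  shows "d = e"
  using assms new_verts_disjoint[of d e n] edge(3) by (auto simp: block_def)

lemma block_subset_verts_CL: "e \<in> edges G \<Longrightarrow> block n e \<subseteq> verts (CL n G)"
  using edge(1) by (auto simp: block_def CL_def)

lemma finite_block: "e \<in> edges G \<Longrightarrow> finite (block n e)"
  using edge(3) by (simp add: block_def finite_new_verts)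

lemma owned_disjoint:
  assumes "d \<in> edges G" "e \<in> edges G" "d \<noteq> e"
  shows "owned q d \<inter> owned q e = {}"
  using assms new_verts_disjoint[of d e n] edge(3) by (auto simp: owned_def)

lemma owned_subset_block: "owned q e \<subseteq> block n e"
  by (auto simp: owned_def block_def)

lemma UN_owned:
  assumes "parent_edges q (verts G - {\<rho>}) \<subseteq> edges G"
  shows "(\<Union>e\<in>edges G. owned q e) = verts (CL n G) - {Old \<rho>}"
  using assms by (auto simp: owned_def CL_def parent_edges_def new_verts_def)

text \<open>
  If \<open>p\<close> keeps every vertex in its own block, then a path of \<open>p\<close>-parents starting at an old vertex
  \<open>u\<close> can leave the block of \<open>{u, q u}\<close> only at \<open>q u\<close>, and a terminating path has to leave it; so
  each step of \<open>q\<close> is simulated by a nonempty sequence of steps of \<open>p\<close>. Conversely, if paths in each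
  block terminate, a path of \<open>p\<close> reaches an old vertex on the boundary of the block it is in, and from
  then on visits old vertices along a path of \<open>q\<close>.
\<close>
lemma wf_step_rel_CL_iff:
  assumes q: "parent_edges q (verts G - {\<rho>}) \<subseteq> edges G"
    and p: "\<And>e x. e \<in> edges G \<Longrightarrow> x \<in> owned q e \<Longrightarrow> p x \<in> block n e"
  shows "wf (step_rel p (verts (CL n G) - {Old \<rho>})) \<longleftrightarrow>
    wf (step_rel q (verts G - {\<rho>})) \<and> (\<forall>e\<in>edges G. wf (step_rel p (owned q e)))"
    (is "wf ?R \<longleftrightarrow> wf ?Q \<and> _")
proof
  have owned: "owned q e \<subseteq> verts (CL n G) - {Old \<rho>}" if "e \<in> edges G" for e
    using UN_owned[OF q] that by blast
  have parent_edge: "{u, q u} \<in> edges G" if "u \<in> verts G - {\<rho>}" for u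
    using q that by (auto simp: parent_edges_def)
  have Old_owned: "Old u \<in> owned q {u, q u}" if "u \<in> verts G - {\<rho>}" for u
    using that by (auto simp: owned_def)
  {
    assume wf: "wf ?R"
    \<comment> \<open>Since \<open>x\<close> comes after \<open>Old u\<close> on a terminating path, it is not \<open>Old u\<close> again; so it is
      \<open>Old (q u)\<close> or a new vertex, whose parent is again in the block.\<close>
    have descend: "(Old (q u), x) \<in> ?R\<^sup>*"
      if u: "u \<in> verts G - {\<rho>}" and "x \<in> block n {u, q u}" "(x, Old u) \<in> ?R\<^sup>+" for u x
      using that(2,3)
    proof (induction x rule: wf_induct_rule[OF wf])
      case (1 x)
      have "x \<noteq> Old u" using 1(3) wf_acyclic[OF wf] unfolding acyclic_def by blast
      then consider "x = Old (q u)" | "x \<in> new_verts n {u, q u}"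
        using 1(2) by (auto simp: block_def)
      then show ?case
      proof cases
        case 2
        then have x: "x \<in> owned q {u, q u}" by (simp add: owned_def)
        then have R: "(p x, x) \<in> ?R"
          using owned[OF parent_edge[OF u]] by (auto intro: step_relI)
        then have "(Old (q u), p x) \<in> ?R\<^sup>*"
          using p[OF parent_edge[OF u] x] 1(3) by (intro 1(1)) (auto intro: trancl_into_trancl2)
        then show ?thesis using R by (rule rtrancl_into_rtrancl)
      qed simp
    qed
    have "(Old (q u), Old u) \<in> ?R\<^sup>+" if u: "u \<in> verts G - {\<rho>}" for u
    proof -
      have R: "(p (Old u), Old u) \<in> ?R"
        using owned[OF parent_edge[OF u]] Old_owned[OF u] by (auto intro: step_relI)
      moreover have "(Old (q u), p (Old u)) \<in> ?R\<^sup>*"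
        using p[OF parent_edge[OF u] Old_owned[OF u]] R by (intro descend[OF u]) auto
      ultimately show ?thesis by (rule rtrancl_into_trancl1[rotated])
    qed
    then have "?Q \<subseteq> inv_image (?R\<^sup>+) Old" by (auto simp: in_step_rel_iff in_inv_image)
    then have "wf ?Q" using wf by (meson wf_inv_image wf_subset wf_trancl)
    moreover have "wf (step_rel p (owned q e))" if "e \<in> edges G" for e
      using wf_subset[OF wf step_rel_mono[OF owned[OF that]]] .
    ultimately show "wf ?Q \<and> (\<forall>e\<in>edges G. wf (step_rel p (owned q e)))" by blast
  }
  assume "wf ?Q \<and> (\<forall>e\<in>edges G. wf (step_rel p (owned q e)))"
  then have wfq: "wf ?Q" and wfp: "\<And>e. e \<in> edges G \<Longrightarrow> wf (step_rel p (owned q e))" by auto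
  have block_acc: "x \<in> Wellfounded.acc ?R"
    if e: "e \<in> edges G" and exits: "\<And>y. y \<in> block n e - owned q e \<Longrightarrow> y \<in> Wellfounded.acc ?R"
      and x: "x \<in> block n e" for e x
    using x
  proof (induction x rule: wf_induct_rule[OF wfp[OF e]])
    case (1 x)
    show ?case
    proof (cases "x \<in> owned q e")
      case True
      show ?thesis
      proof (rule accI)
        fix y assume "(y, x) \<in> ?R"
        then have "y = p x" by (simp add: in_step_rel_iff)
        then show "y \<in> Wellfounded.acc ?R" using 1(1)[OF step_relI[OF True]] p[OF e True] by simp
      qed
    qed (use exits 1(2) in blast)
  qed
  have old_acc: "u \<in> verts G \<longrightarrow> Old u \<in> Wellfounded.acc ?R" for u
  proof (induction u rule: wf_induct_rule[OF wfq])
    case (1 u)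
    show ?case
    proof
      assume "u \<in> verts G"
      show "Old u \<in> Wellfounded.acc ?R"
      proof (cases "u = \<rho>")
        case True
        show ?thesis by (rule accI) (use True in \<open>simp add: in_step_rel_iff\<close>)
      next
        case False
        then have u: "u \<in> verts G - {\<rho>}" using \<open>u \<in> verts G\<close> by simp
        have "q u \<in> verts G" using edge(1)[OF parent_edge[OF u]] by simp
        then have parent: "Old (q u) \<in> Wellfounded.acc ?R" using 1[OF step_relI[OF u]] by simp
        show ?thesis
        proof (rule block_acc[OF parent_edge[OF u]])
          fix y assume y: "y \<in> block n {u, q u} - owned q {u, q u}"
          then have "y = Old (q u)" using Old_owned[OF u] by (auto simp: block_def owned_def)
          then show "y \<in> Wellfounded.acc ?R" using parent by simp
        qed simp
      qed
    qed
  qed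
  have "x \<in> Wellfounded.acc ?R" for x
  proof (cases "x \<in> verts (CL n G) - {Old \<rho>}")
    case True
    then obtain e where e: "e \<in> edges G" "x \<in> owned q e" using UN_owned[OF q] by blast
    show ?thesis
    proof (rule block_acc[OF e(1)])
      fix y assume "y \<in> block n e - owned q e"
      then obtain u where "u \<in> e" "y = Old u" by (auto simp: block_def owned_def)
      then show "y \<in> Wellfounded.acc ?R" using old_acc edge(1)[OF e(1)] by blast
    qed (use e owned_subset_block in blast)
  next
    case False
    show ?thesis by (rule accI) (use False in \<open>simp add: in_step_rel_iff\<close>)
  qed
  then show "wf ?R" unfolding wf_iff_acc by blast
qed

lemma fibreD:
  assumes "p \<in> fibre q" "e \<in> edges G"
  shows "wf (step_rel p (owned q e))" and "x \<in> owned q e \<Longrightarrow> p x \<in> block n e"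
proof -
  have *: "restrict p (owned q e) \<in> owned q e \<rightarrow>\<^sub>E block n e"
    "wf (step_rel (restrict p (owned q e)) (owned q e))"
    using assms by (simp_all add: fibre_def acyclic_maps_def)
  have "step_rel (restrict p (owned q e)) (owned q e) = step_rel p (owned q e)"
    by (rule step_rel_cong) simp
  then show "wf (step_rel p (owned q e))" using *(2) by simp
  show "x \<in> owned q e \<Longrightarrow> p x \<in> block n e" using PiE_mem[OF *(1), of x] by simp
qed

lemma fibreI:
  assumes "p \<in> extensional (verts (CL n G) - {Old \<rho>})"
    and "\<And>e. e \<in> edges G \<Longrightarrow> wf (step_rel p (owned q e))"
    and "\<And>e x. e \<in> edges G \<Longrightarrow> x \<in> owned q e \<Longrightarrow> p x \<in> block n e"
  shows "p \<in> fibre q"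
proof -
  have "step_rel (restrict p (owned q e)) (owned q e) = step_rel p (owned q e)" for e
    by (rule step_rel_cong) simp
  then show ?thesis using assms by (auto simp: fibre_def acyclic_maps_def)
qed

lemma fibre_subset_arborescences_CL:
  assumes q: "q \<in> arborescences G \<rho>"
  shows "fibre q \<subseteq> arborescences (CL n G) (Old \<rho>)"
proof
  fix p assume p: "p \<in> fibre q"
  let ?D = "verts (CL n G) - {Old \<rho>}"
  have PE: "parent_edges q (verts G - {\<rho>}) \<subseteq> edges G" using q by (simp add: arborescences_def)
  have wf: "wf (step_rel p ?D)"
  proof (rule iffD2[OF wf_step_rel_CL_iff[OF PE]])
    show "p x \<in> block n e" if "e \<in> edges G" "x \<in> owned q e" for e x
      using fibreD(2)[OF p that] .
    show "wf (step_rel q (verts G - {\<rho>})) \<and> (\<forall>e\<in>edges G. wf (step_rel p (owned q e)))"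
      using arborescencesD(1)[OF q] fibreD(1)[OF p] by simp
  qed
  have step: "p x \<in> verts (CL n G) \<and> {x, p x} \<in> edges (CL n G)" if "x \<in> ?D" for x
  proof -
    obtain e where e: "e \<in> edges G" "x \<in> owned q e" using UN_owned[OF PE] \<open>x \<in> ?D\<close> by blast
    then have "p x \<in> block n e" "x \<in> block n e" using fibreD(2)[OF p] owned_subset_block by blast+
    moreover have "p x \<noteq> x" using step_rel_neq[OF wf that] .
    ultimately have "{x, p x} \<in> clique_edges (block n e)" by (simp add: clique_edges_def)
    then show ?thesis
      using e(1) \<open>p x \<in> block n e\<close> block_subset_verts_CL edges_CL[OF simple] by blast
  qed
  moreover have "p \<in> extensional ?D" using p by (simp add: fibre_def)
  ultimately show "p \<in> arborescences (CL n G) (Old \<rho>)"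
    using wf by (auto simp: arborescences_def acyclic_maps_def parent_edges_def PiE_def)
qed

text \<open>
  The parent of an old vertex \<open>u\<close> shares a block with \<open>u\<close>, and the other end of the edge of that
  block is the parent of \<open>u\<close> in \<open>G\<close>.
\<close>
lemma arborescence_CL_in_fibre:
  assumes p: "p \<in> arborescences (CL n G) (Old \<rho>)"
  obtains q where "q \<in> arborescences G \<rho>" "p \<in> fibre q"
proof -
  let ?D = "verts G - {\<rho>}" and ?D' = "verts (CL n G) - {Old \<rho>}"
  have step: "\<exists>e\<in>edges G. x \<in> block n e \<and> p x \<in> block n e" if "x \<in> ?D'" for x
  proof -
    have "{x, p x} \<in> edges (CL n G)" using arborescencesD(3)[OF p, of x] that by simp
    then show ?thesis unfolding edges_CL[OF simple] by (auto simp: clique_edges_def)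
  qed
  have "\<exists>v. {u, v} \<in> edges G \<and> p (Old u) \<in> block n {u, v}" if "u \<in> ?D" for u
  proof -
    have "Old u \<in> verts (CL n G) - {Old \<rho>}" using that by (simp add: CL_def)
    from step[OF this] obtain e where e: "e \<in> edges G" "u \<in> e" "p (Old u) \<in> block n e"
      by auto
    then obtain v where "e = {u, v}" using edge(2)[OF e(1)] by (auto simp: card_2_iff)
    then show ?thesis using e by blast
  qed
  then obtain q' where q': "\<And>u. u \<in> ?D \<Longrightarrow> {u, q' u} \<in> edges G \<and> p (Old u) \<in> block n {u, q' u}"
    by metis
  define q where "q = restrict q' ?D"
  have PE: "parent_edges q ?D \<subseteq> edges G" using q' by (auto simp: q_def parent_edges_def)
  have stays: "p x \<in> block n e" if e: "e \<in> edges G" and x: "x \<in> owned q e" for e x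
  proof (cases "x \<in> new_verts n e")
    case True
    have "x \<in> ?D'" using UN_owned[OF PE] that by blast
    then obtain d where "d \<in> edges G" "x \<in> block n d" "p x \<in> block n d" using step by blast
    then show ?thesis using new_verts_block_unique[OF e _ True] by blast
  next
    case False
    then obtain u where "u \<in> ?D" "x = Old u" "e = {u, q u}" using x by (auto simp: owned_def)
    then show ?thesis using q' by (simp add: q_def)
  qed
  have wf: "wf (step_rel q ?D)" "\<And>e. e \<in> edges G \<Longrightarrow> wf (step_rel p (owned q e))"
    using iffD1[OF wf_step_rel_CL_iff[OF PE, of p] arborescencesD(1)[OF p]] stays by blast+
  have "q u \<in> verts G" if "u \<in> ?D" for u
    using q'[OF that] edge(1)[of "{u, q' u}"] that by (simp add: q_def)
  then have "q \<in> ?D \<rightarrow>\<^sub>E verts G" by (intro PiE_I) (auto simp: q_def)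
  then have "q \<in> arborescences G \<rho>" using wf(1) PE by (simp add: arborescences_def acyclic_maps_def)
  moreover have "p \<in> fibre q"
    using p by (intro fibreI wf stays) (auto simp: arborescences_def acyclic_maps_def PiE_def)
  ultimately show thesis using that by blast
qed

text \<open>
  Two blocks containing \<open>u\<close> have nothing but \<open>u\<close> in common, so the parent of \<open>u\<close> in the blow-up
  determines the parent of \<open>u\<close> in \<open>G\<close>.
\<close>
lemma fibre_disjoint:
  assumes q: "q \<in> arborescences G \<rho>" and q': "q' \<in> arborescences G \<rho>"
    and p: "p \<in> fibre q" "p \<in> fibre q'"
  shows "q = q'"
proof
  fix u
  show "q u = q' u"
  proof (cases "u \<in> verts G - {\<rho>}")
    case True
    let ?d = "{u, q u}" and ?e = "{u, q' u}"
    have e: "?d \<in> edges G" "?e \<in> edges G"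
      using True arborescencesD(3)[OF q, of u] arborescencesD(3)[OF q', of u] by auto
    have owned: "Old u \<in> owned q ?d" "Old u \<in> owned q' ?e" using True by (auto simp: owned_def)
    have "p (Old u) \<in> block n ?d" "p (Old u) \<in> block n ?e"
      using fibreD(2)[OF p(1) e(1) owned(1)] fibreD(2)[OF p(2) e(2) owned(2)] .
    moreover have "p (Old u) \<noteq> Old u"
      using step_rel_neq[OF fibreD(1)[OF p(1) e(1)] owned(1)] .
    ultimately have "?d = ?e \<or> p (Old u) \<in> Old ` (?d \<inter> ?e) - {Old u}"
      using block_inter[of ?d ?e n] by blast
    then show ?thesis by (auto simp: doubleton_eq_iff)
  next
    case False
    then show ?thesis using arborescencesD(4)[OF q, of u] arborescencesD(4)[OF q', of u] by simp
  qed
qed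

text \<open>
  A block of a parent edge carries a forest with a single root, that is a tree; any other block
  carries a forest with the two ends of the edge as its roots.
\<close>
lemma card_acyclic_maps_block:
  assumes q: "q \<in> arborescences G \<rho>" and e: "e \<in> edges G"
  shows "card (acyclic_maps (owned q e) (block n e)) =
    (if e \<in> parent_edges q (verts G - {\<rho>}) then n ^ (n - 2) else 2 * n ^ (n - 3))"
proof -
  let ?U = "{u \<in> verts G - {\<rho>}. {u, q u} = e}"
  have block: "card (block n e) = n" using card_block[OF n edge(2)[OF e]] by (simp add: block_def)
  have finU: "finite ?U" using finite_verts by simp
  have "card (owned q e) = card (new_verts n e) + card (Old ` ?U)"
    unfolding owned_def using finU finite_new_verts by (intro card_Un_disjoint) auto
  then have owned: "card (owned q e) = n - 2 + card ?U"
    by (simp add: card_new_verts card_image inj_on_def)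
  have diff: "card (block n e - owned q e) = n - card (owned q e)"
    using card_Diff_subset[OF finite_subset[OF owned_subset_block finite_block[OF e]] owned_subset_block]
    by (simp add: block)
  have count: "card (acyclic_maps (owned q e) (block n e)) * n
      = (n - card (owned q e)) * n ^ card (owned q e)"
    using card_acyclic_maps[OF finite_block[OF e] owned_subset_block, of q] by (simp add: block diff)
  show ?thesis
  proof (cases "e \<in> parent_edges q (verts G - {\<rho>})")
    case True
    then obtain u where u: "u \<in> ?U" by (auto simp: parent_edges_def)
    then have "?U = {u}"
      using inj_onD[OF inj_on_parent_edge[OF arborescencesD(1)[OF q]]] by auto
    then have "card (owned q e) = Suc (n - 2)" using owned by simp
    then have "card (acyclic_maps (owned q e) (block n e)) * n = n ^ (n - 2) * n"
      using count n by (simp add: Suc_diff_le)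
    then show ?thesis using True n by simp
  next
    case False
    then have "?U = {}" by (auto simp: parent_edges_def)
    then have "card (owned q e) = Suc (n - 3)" using owned n by (simp only: card.empty)
    moreover have "n - Suc (n - 3) = 2" using n by simp
    ultimately have "card (acyclic_maps (owned q e) (block n e)) * n = (2 * n ^ (n - 3)) * n"
      using count by (simp only: power_Suc mult_ac)
    then show ?thesis using False n by auto
  qed
qed

lemma card_fibre:
  assumes q: "q \<in> arborescences G \<rho>"
  shows "card (fibre q) = (n ^ (n - 2)) ^ (card (verts G) - 1)
     * (2 * n ^ (n - 3)) ^ (card (edges G) - (card (verts G) - 1))"
proof -
  let ?P = "parent_edges q (verts G - {\<rho>})"
  have PE: "?P \<subseteq> edges G" using q by (simp add: arborescences_def)
  have "card ?P = card (verts G) - 1"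
    using card_image[OF inj_on_parent_edge[OF arborescencesD(1)[OF q]]] root finite_verts
    by (simp add: parent_edges_def)
  moreover have "edges G \<inter> {e. e \<in> ?P} = ?P" "edges G \<inter> - {e. e \<in> ?P} = edges G - ?P"
    using PE by auto
  moreover have "card (edges G - ?P) = card (edges G) - card ?P"
    using PE finite_edges by (intro card_Diff_subset finite_subset[OF PE]) auto
  moreover have "card (fibre q) = (\<Prod>e\<in>edges G. card (acyclic_maps (owned q e) (block n e)))"
    unfolding fibre_def UN_owned[OF PE, symmetric]
    by (rule card_glued_functions[OF finite_edges owned_disjoint])
      (auto simp: acyclic_maps_def PiE_def)
  moreover have "\<dots> = (\<Prod>e\<in>edges G. if e \<in> ?P then n ^ (n - 2) else 2 * n ^ (n - 3))"
    by (intro prod.cong refl card_acyclic_maps_block[OF q])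
  ultimately show ?thesis
    using finite_edges by (simp add: prod.If_cases)
qed

theorem num_spanning_trees_CL:
  "\<tau> (CL n G) = (n ^ (n - 2)) ^ (card (verts G) - 1)
     * (2 * n ^ (n - 3)) ^ (card (edges G) - (card (verts G) - 1)) * \<tau> G"
proof -
  let ?A = "arborescences G \<rho>"
  have fin: "finite (arborescences H \<sigma>)" if "finite_simple_graph H" for H :: "'b ugraph" and \<sigma>
    using finite_acyclic_maps[of "verts H - {\<sigma>}" "verts H"] that
    by (simp add: arborescences_def finite_simple_graph_def)
  have "arborescences (CL n G) (Old \<rho>) = (\<Union>q\<in>?A. fibre q)"
  proof
    show "arborescences (CL n G) (Old \<rho>) \<subseteq> (\<Union>q\<in>?A. fibre q)"
    proof
      fix p assume "p \<in> arborescences (CL n G) (Old \<rho>)"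
      then obtain q where "q \<in> ?A" "p \<in> fibre q" by (rule arborescence_CL_in_fibre)
      then show "p \<in> (\<Union>q\<in>?A. fibre q)" by blast
    qed
    show "(\<Union>q\<in>?A. fibre q) \<subseteq> arborescences (CL n G) (Old \<rho>)"
      by (rule UN_least) (rule fibre_subset_arborescences_CL)
  qed
  moreover have "card (\<Union>q\<in>?A. fibre q) = (\<Sum>q\<in>?A. card (fibre q))"
  proof (rule card_UN_disjoint[OF fin[OF simple]])
    show "\<forall>q\<in>?A. finite (fibre q)"
      using finite_subset[OF fibre_subset_arborescences_CL fin[OF finite_simple_graph_CL[OF simple]]]
      by simp
    show "\<forall>q\<in>?A. \<forall>q'\<in>?A. q \<noteq> q' \<longrightarrow> fibre q \<inter> fibre q' = {}" using fibre_disjoint by blast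
  qed
  moreover have "\<tau> (CL n G) = card (arborescences (CL n G) (Old \<rho>))"
    using root
    by (intro num_spanning_trees_eq_card_arborescences finite_simple_graph_CL simple) (simp add: CL_def)
  moreover have "\<tau> G = card ?A"
    by (rule num_spanning_trees_eq_card_arborescences[OF simple root])
  ultimately show ?thesis by (simp add: card_fibre)
qed

end

lemma card_verts_CL:
  assumes "finite_simple_graph G"
  shows "card (verts (CL n G)) = card (verts G) + (n - 2) * card (edges G)"
proof -
  note fin = simple_graph_finite(1)[OF assms] simple_graph_edge(3)[OF assms]
    and finE = simple_graph_finite(2)[OF assms]
  have "card (verts (CL n G)) = card (Old ` verts G) + card (\<Union>e\<in>edges G. new_verts n e)"
    unfolding CL_def using fin finE
    by (simp, intro card_Un_disjoint) (auto simp: finite_new_verts)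
  also have "card (\<Union>e\<in>edges G. new_verts n e) = (\<Sum>e\<in>edges G. card (new_verts n e))"
    using finE by (rule card_UN_disjoint) (simp_all add: finite_new_verts new_verts_disjoint fin(2))
  finally show ?thesis by (simp add: card_new_verts card_image inj_on_def)
qed

text \<open>
  Blocks of distinct edges share at most one vertex and hence no edge.
\<close>
lemma card_edges_CL:
  assumes "finite_simple_graph G" "3 \<le> n"
  shows "card (edges (CL n G)) = card (edges G) * (n choose 2)"
proof -
  note edge = simple_graph_edge(2,3)[OF assms(1)]
    and finE = simple_graph_finite(2)[OF assms(1)]
  have block: "finite (block n e)" "card (block n e) = n" if "e \<in> edges G" for e
    using that edge card_block[OF assms(2) edge(1)] by (simp_all add: block_def finite_new_verts)
  have disj: "clique_edges (block n d) \<inter> clique_edges (block n e) = {}"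
    if "d \<in> edges G" "e \<in> edges G" "d \<noteq> e" for d e
  proof -
    have "card (d \<inter> e) < card d"
    proof (rule psubset_card_mono)
      have "\<not> d \<subseteq> e"
        using card_subset_eq[OF edge(2)[OF that(2)], of d] edge(1) that by auto
      then show "d \<inter> e \<subset> d" by blast
    qed (use edge that in simp)
    then have small: "card (Old ` (d \<inter> e)) < 2" "finite (Old ` (d \<inter> e))"
      using edge that by (simp_all add: card_image inj_on_def)
    show ?thesis
    proof (rule equals0I)
      fix f assume "f \<in> clique_edges (block n d) \<inter> clique_edges (block n e)"
      then have "f \<subseteq> block n d \<inter> block n e" "card f = 2" by (auto simp: clique_edges_def)
      then have "f \<subseteq> Old ` (d \<inter> e)" using block_inter[of d e n] edge that by simp
      then show False using card_mono[OF small(2), of f] small(1) \<open>card f = 2\<close> by simp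
    qed
  qed
  have clique: "finite (clique_edges (block n e)) \<and> card (clique_edges (block n e)) = n choose 2"
    if "e \<in> edges G" for e
    using n_subsets[OF block(1)[OF that], of 2] block[OF that] by (simp add: clique_edges_def)
  have "card (edges (CL n G)) = (\<Sum>e\<in>edges G. card (clique_edges (block n e)))"
    unfolding edges_CL[OF assms(1)] using finE clique disj by (intro card_UN_disjoint) auto
  then show ?thesis using clique by simp
qed

text \<open>
  With real exponents the factor needs no truncated subtraction. A disconnected graph may have fewer
  than \<open>card (verts G) - 1\<close> edges, but then both sides vanish.
\<close>
lemma num_spanning_trees_CL_powr:
  assumes n: "3 \<le> n" and G: "finite_simple_graph G" and ne: "verts G \<noteq> {}"
  shows "real (\<tau> (CL n G)) =
    2 powr (real (card (edges G)) - real (card (verts G)) + 1)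
    * real n powr ((real n - 3) * real (card (edges G)) + real (card (verts G)) - 1)
    * real (\<tau> G)"
proof -
  obtain \<rho> where root: "\<rho> \<in> verts G" using ne by blast
  interpret blow_up n G \<rho> by unfold_locales (fact n G root)+
  show ?thesis
  proof (cases "\<tau> G = 0")
    case True
    then show ?thesis using num_spanning_trees_CL by simp
  next
    case False
    then have "arborescences G \<rho> \<noteq> {}"
      unfolding num_spanning_trees_eq_card_arborescences[OF G root] by auto
    then obtain q where q: "q \<in> arborescences G \<rho>" by blast
    \<comment> \<open>The existence of a spanning tree bounds the number of edges from below.\<close>
    have "card (parent_edges q (verts G - {\<rho>})) = card (verts G) - 1"
      using card_image[OF inj_on_parent_edge[OF arborescencesD(1)[OF q]]] root finite_verts
      by (simp add: parent_edges_def)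
    moreover have "parent_edges q (verts G - {\<rho>}) \<subseteq> edges G" using q by (simp add: arborescences_def)
    ultimately have "card (verts G) - 1 \<le> card (edges G)" using card_mono[OF finite_edges] by metis
    then obtain M where M: "card (edges G) = (card (verts G) - 1) + M" using le_Suc_ex by blast
    obtain m where m: "card (verts G) = Suc m"
      using root finite_verts by (metis card_eq_0_iff empty_iff not0_implies_Suc)
    obtain j where j: "n = j + 3" using n by (metis add.commute le_Suc_ex)
    have E: "card (edges G) = m + M" using M m by simp
    have "\<tau> (CL n G) = (n ^ (j + 1)) ^ m * (2 * n ^ j) ^ M * \<tau> G"
      using num_spanning_trees_CL by (simp add: m E j)
    also have "\<dots> = 2 ^ M * n ^ (j * (m + M) + m) * \<tau> G"
      by (simp add: power_mult_distrib algebra_simps flip: power_mult power_add)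
    finally have "real (\<tau> (CL n G)) = 2 ^ M * real n ^ (j * (m + M) + m) * real (\<tau> G)" by simp
    moreover have "2 ^ M = (2::real) powr (real (card (edges G)) - real (card (verts G)) + 1)"
      by (simp add: E m powr_realpow)
    moreover have "real n ^ (j * (m + M) + m)
        = real n powr ((real n - 3) * real (card (edges G)) + real (card (verts G)) - 1)"
      using n by (subst powr_realpow[symmetric]) (simp_all add: E m j)
    ultimately show ?thesis by simp
  qed
qed

section \<open>Renaming vertices and iterating the blow-up\<close>

lemma arborescences_rename_iff:
  assumes f: "inj f" and q: "q \<in> verts G - {\<rho>} \<rightarrow>\<^sub>E verts G"
  shows "(\<lambda>x\<in>f ` (verts G - {\<rho>}). f (q (inv f x))) \<in>
      arborescences \<lparr>verts = f ` verts G, edges = (`) f ` edges G\<rparr> (f \<rho>)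
    \<longleftrightarrow> q \<in> arborescences G \<rho>"
proof -
  let ?D = "verts G - {\<rho>}"
  define p where "p = (\<lambda>x\<in>f ` ?D. f (q (inv f x)))"
  have p_f: "p (f u) = f (q u)" if "u \<in> ?D" for u using that f by (simp add: p_def)
  have D: "f ` verts G - {f \<rho>} = f ` ?D" using f by (auto dest: injD)
  have "step_rel p (f ` ?D) = map_prod f f ` step_rel q ?D"
    using p_f by (force simp: step_rel_def)
  moreover have "wf (map_prod f f ` step_rel q ?D) \<longleftrightarrow> wf (step_rel q ?D)"
  proof
    assume "wf (map_prod f f ` step_rel q ?D)"
    then have "wf (inv_image (map_prod f f ` step_rel q ?D) f)" by (rule wf_inv_image)
    then show "wf (step_rel q ?D)" by (rule wf_subset) force
  qed (use f in \<open>blast intro: wf_map_prod_image\<close>)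
  ultimately have wf: "wf (step_rel p (f ` ?D)) \<longleftrightarrow> wf (step_rel q ?D)" by simp
  have "parent_edges p (f ` ?D) = (`) f ` parent_edges q ?D"
    unfolding parent_edges_def image_image by (rule image_cong) (use p_f in simp_all)
  then have "parent_edges p (f ` ?D) \<subseteq> (`) f ` edges G \<longleftrightarrow> parent_edges q ?D \<subseteq> edges G"
    using f by (simp add: inj_image_subset_iff inj_image_eq_iff inj_on_def)
  moreover have "p \<in> f ` ?D \<rightarrow>\<^sub>E f ` verts G"
  proof (rule PiE_I)
    show "p x \<in> f ` verts G" if "x \<in> f ` ?D" for x
      using that p_f PiE_mem[OF q] by force
  qed (simp add: p_def)
  ultimately show ?thesis
    unfolding p_def[symmetric] arborescences_def acyclic_maps_def using wf q D by simp
qed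

lemma num_spanning_trees_rename:
  fixes f :: "'a \<Rightarrow> 'b"
  assumes f: "inj f" and G: "finite_simple_graph G" and \<rho>: "\<rho> \<in> verts G"
  shows "\<tau> \<lparr>verts = f ` verts G, edges = (`) f ` edges G\<rparr> = \<tau> G"
    and "finite_simple_graph \<lparr>verts = f ` verts G, edges = (`) f ` edges G\<rparr>"
proof -
  let ?H = "\<lparr>verts = f ` verts G, edges = (`) f ` edges G\<rparr>" and ?D = "verts G - {\<rho>}"
  let ?F = "\<lambda>q. \<lambda>x\<in>f ` ?D. f (q (inv f x))"
  have card: "card (f ` e) = card e" for e by (rule card_image) (use f in \<open>blast intro: inj_on_subset\<close>)
  then show H: "finite_simple_graph ?H" using G by (auto simp: finite_simple_graph_def)
  have D: "f ` verts G - {f \<rho>} = f ` ?D" using f by (auto dest: injD)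
  have arb: "q \<in> ?D \<rightarrow>\<^sub>E verts G" if "q \<in> arborescences G \<rho>" for q
    using that by (simp add: arborescences_def acyclic_maps_def)
  have "bij_betw ?F (arborescences G \<rho>) (arborescences ?H (f \<rho>))"
  proof (rule bij_betw_imageI)
    show "inj_on ?F (arborescences G \<rho>)"
    proof (rule inj_onI)
      fix q q' assume q: "q \<in> arborescences G \<rho>" "q' \<in> arborescences G \<rho>" and eq: "?F q = ?F q'"
      show "q = q'"
      proof (rule PiE_ext[OF arb[OF q(1)] arb[OF q(2)]])
        fix u assume "u \<in> ?D"
        then show "q u = q' u" using fun_cong[OF eq, of "f u"] f by (simp add: inj_eq)
      qed
    qed
    show "?F ` arborescences G \<rho> = arborescences ?H (f \<rho>)"
    proof
      show "?F ` arborescences G \<rho> \<subseteq> arborescences ?H (f \<rho>)"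
        using arborescences_rename_iff[OF f arb] by blast
      show "arborescences ?H (f \<rho>) \<subseteq> ?F ` arborescences G \<rho>"
      proof
        fix p assume p: "p \<in> arborescences ?H (f \<rho>)"
        then have pPi: "p \<in> f ` ?D \<rightarrow>\<^sub>E f ` verts G"
          by (simp add: arborescences_def acyclic_maps_def D)
        define q where "q = (\<lambda>u\<in>?D. inv f (p (f u)))"
        have pq: "q u \<in> verts G \<and> p (f u) = f (q u)" if u: "u \<in> ?D" for u
        proof -
          have "p (f u) \<in> f ` verts G" using PiE_mem[OF pPi] u by blast
          then show ?thesis using u f by (auto simp: q_def)
        qed
        have q: "q \<in> ?D \<rightarrow>\<^sub>E verts G"
        proof (rule PiE_I)
          show "q u = undefined" if "u \<notin> ?D" for u using that by (simp only: q_def restrict_def if_False)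
        qed (use pq in blast)
        have "p = ?F q"
        proof (rule PiE_ext[OF pPi])
          show "?F q \<in> f ` ?D \<rightarrow>\<^sub>E f ` verts G" using pq f by auto
          show "p x = ?F q x" if x: "x \<in> f ` ?D" for x
          proof -
            obtain u where "u \<in> ?D" "x = f u" using x by blast
            then show ?thesis using pq[of u] f by simp
          qed
        qed
        then have "q \<in> arborescences G \<rho>" using p arborescences_rename_iff[OF f q] by simp
        then show "p \<in> ?F ` arborescences G \<rho>" using \<open>p = ?F q\<close> by blast
      qed
    qed
  qed
  then have "card (arborescences G \<rho>) = card (arborescences ?H (f \<rho>))" by (rule bij_betw_same_card)
  moreover have "f \<rho> \<in> verts ?H" using \<rho> by simp
  ultimately show "\<tau> ?H = \<tau> G"
    using num_spanning_trees_eq_card_arborescences[OF H] num_spanning_trees_eq_card_arborescences[OF G \<rho>]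
    by simp
qed

text \<open>
  Here \<open>x r\<close> and \<open>y r\<close> are the sums, over the iterates before the \<open>r\<close>-th, of the exponents of \<open>2\<close> and
  of \<open>n\<close> contributed by one blow-up. The vertex counts are in closed form because
  \<open>n - 2 = 2 / (n + 1) * (b - 1)\<close>, which makes the added vertices telescope.
\<close>

lemma CL_iter_counts:
  fixes G :: "'a ugraph" and n r :: nat
  defines "b \<equiv> real n * (real n - 1) / 2" and "N \<equiv> real (card (verts G))"
    and "E \<equiv> real (card (edges G))"
  defines "s \<equiv> \<lambda>r. (\<Sum>k<r. b ^ k)"
  defines "x \<equiv> \<lambda>r. E * s r - real r * N - 2 * E / (real n + 1) * (s r - real r) + real r"
    and "y \<equiv> \<lambda>r. (real n - 3) * E * s r + real r * N
      + 2 * E / (real n + 1) * (s r - real r) - real r"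
  assumes n: "3 \<le> n" and G: "finite_simple_graph G" and ne: "verts G \<noteq> {}"
  shows "finite_simple_graph (CL_iter n r G) \<and> verts (CL_iter n r G) \<noteq> {}
    \<and> real (card (edges (CL_iter n r G))) = E * b ^ r
    \<and> real (card (verts (CL_iter n r G))) = N + 2 * E / (real n + 1) * (b ^ r - 1)
    \<and> real (\<tau> (CL_iter n r G)) = 2 powr x r * real n powr y r * real (\<tau> G)"
proof (induction r)
  case 0
  obtain \<rho> where \<rho>: "\<rho> \<in> verts G" using ne by blast
  have inj: "inj Init" by (simp add: inj_def)
  have "card ((`) Init ` edges G) = card (edges G)" "card (Init ` verts G) = card (verts G)"
    by (auto intro!: card_image simp: inj_on_def inj_image_eq_iff[OF inj])
  then show ?case
    using num_spanning_trees_rename[OF inj G \<rho>] ne n by (simp add: N_def E_def s_def x_def y_def)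
next
  case (Suc r)
  let ?H = "CL_iter n r G"
  have H: "finite_simple_graph ?H" "verts ?H \<noteq> {}" using Suc by auto
  have EH: "real (card (edges ?H)) = E * b ^ r"
    and NH: "real (card (verts ?H)) = N + 2 * E / (real n + 1) * (b ^ r - 1)" using Suc by auto
  have choose: "real (n choose 2) = b"
  proof -
    have "even (n * (n - 1))" by (cases "even n") simp_all
    then show ?thesis using n by (simp add: choose_two b_def real_of_nat_div of_nat_diff)
  qed
  have "real (card (edges (CL n ?H))) = E * b ^ Suc r"
    using card_edges_CL[OF H(1) n] EH choose by simp
  moreover have "real (card (verts (CL n ?H))) = N + 2 * E / (real n + 1) * (b ^ Suc r - 1)"
  proof -
    have b: "real n - 2 = 2 / (real n + 1) * (b - 1)" by (simp add: b_def field_simps)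
    have "real (card (verts (CL n ?H))) = real (card (verts ?H)) + (real n - 2) * (E * b ^ r)"
      using card_verts_CL[OF H(1), of n] EH n by (simp add: of_nat_diff)
    then show ?thesis unfolding NH b by (simp add: algebra_simps diff_divide_distrib add_divide_distrib)
  qed
  moreover have "verts (CL n ?H) \<noteq> {}" using H(2) by (simp add: CL_def)
  moreover have "real (\<tau> (CL n ?H)) = 2 powr x (Suc r) * real n powr y (Suc r) * real (\<tau> G)"
  proof -
    define c where "c = 2 * E / (real n + 1)"
    have s: "s (Suc r) = s r + b ^ r" by (simp add: s_def)
    have x: "x (Suc r) = (E * b ^ r - (N + c * (b ^ r - 1)) + 1) + x r"
      and y: "y (Suc r) = ((real n - 3) * (E * b ^ r) + (N + c * (b ^ r - 1)) - 1) + y r"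
      unfolding x_def y_def s c_def[symmetric] by (simp_all add: algebra_simps)
    have "real (\<tau> (CL n ?H)) = 2 powr (E * b ^ r - (N + c * (b ^ r - 1)) + 1)
        * real n powr ((real n - 3) * (E * b ^ r) + (N + c * (b ^ r - 1)) - 1) * real (\<tau> ?H)"
      using num_spanning_trees_CL_powr[OF n H] unfolding EH NH c_def .
    moreover have "real (\<tau> ?H) = 2 powr x r * real n powr y r * real (\<tau> G)" using Suc by blast
    ultimately show ?thesis unfolding x y powr_add by (simp only: mult_ac)
  qed
  ultimately show ?case using finite_simple_graph_CL[OF H(1), of n] by simp
qed

theorem theorem4p4:
  fixes G :: "'a ugraph" and n r N\<^sub>0 E\<^sub>0 :: nat and \<alpha> :: real
  assumes "n \<ge> 3" and "r \<ge> 1"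
    and "finite_simple_graph G" and "connected_graph G"
    and "N\<^sub>0 = card (verts G)" and "E\<^sub>0 = card (edges G)"
    and "\<alpha> = ((real n ^ r * (real n - 1) ^ r) / 2 ^ r - 1) / (real n ^ 2 - real n - 2)"
  shows "real (\<tau> (CL_iter n r G)) =
    2 powr (2 * real E\<^sub>0 * \<alpha> - real r * real N\<^sub>0
            - 2 * real E\<^sub>0 / (real n + 1) * (2 * \<alpha> - real r) + real r)
    * real n powr (2 * (real n - 3) * real E\<^sub>0 * \<alpha> + real r * real N\<^sub>0
            + 2 * real E\<^sub>0 / (real n + 1) * (2 * \<alpha> - real r) - real r)
    * real (\<tau> G)"
proof -
  let ?b = "real n * (real n - 1) / 2"
  have ne: "verts G \<noteq> {}" using assms(4) by (simp add: connected_graph_def)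
  have "3 * 2 \<le> real n * (real n - 1)" using assms(1) by (intro mult_mono) auto
  then have "?b \<noteq> 1" by simp
  then have "(\<Sum>k<r. ?b ^ k) = (?b ^ r - 1) / (?b - 1)" by (rule geometric_sum)
  also have "\<dots> = 2 * \<alpha>"
  proof -
    have "real n ^ 2 - real n - 2 = 2 * (?b - 1)" by (simp add: power2_eq_square algebra_simps)
    moreover have "?b ^ r = real n ^ r * (real n - 1) ^ r / 2 ^ r"
      by (simp add: power_mult_distrib power_divide)
    moreover have "x / y = 2 * (x / (2 * y))" for x y :: real by simp
    ultimately show ?thesis unfolding assms(7) by metis
  qed
  finally have s: "(\<Sum>k<r. ?b ^ k) = 2 * \<alpha>" .
  show ?thesis
    using CL_iter_counts[OF assms(1,3) ne, of r] unfolding s assms(5,6) by (simp add: mult_ac)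
qed

end
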